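(* Let $R$ be an authentic execution (as defined in the context) of Algorithm A (given in the context). Then the system demonstrates in $R$ the construction of a multivalued consensus object. That is, saying that $p_i$ *decides* $v$ when $\mathsf{result}_i()$ returns $v\notin\{\bot,\text{ERR}\}$, the multivalued consensus task, in which every processor $p_i$ proposes a value $v_i$ by invoking $\mathsf{propose}_i(v_i)$, is satisfied in $R$: (Validity) if $v$ is decided, then some processor invoked $\mathsf{propose}(v)$; (Termination) all non-faulty processors decide; (Agreement) no two processors decide different values; (Integrity) no processor decides more than once, i.e., if $\mathsf{result}_j()=v'\notin\{\bot,\text{ERR}\}$ in some state of $R$, then there is no state of $R$ in which $\mathsf{result}_j()=v''\notin\{\bot,\text{ERR}\}$ with $v''\ne v'$.
   Context: **System.** An asynchronous message-passing system has $n$ processors $\mathcal P=\{p_0,\dots,p_{n-1}\}$. At most $t<n/2$ of them crash; $\mathit{Correct}$ is the set of indices of processors that never crash. There are no bounds on delays and no clocks. Channels have bounded capacity and may omit, duplicate and reorder packets. They satisfy fair communication: a message sent infinitely often by $p_i$ to $p_j$ is received infinitely often. An execution is an alternating sequence of system states and atomic steps. **Assumed building blocks.** - *Uniform reliable broadcast (URB).* $\mathsf{urbBroadcast}\ m$ returns a descriptor $\mathit{txDes}$. URB-validity: no spontaneous creation or alteration of messages. URB-integrity: no duplication. URB-termination: if the sender is correct, or some processor URB-delivers $m$, then all correct processors URB-deliver $m$. The predicate $\mathsf{hasTerminated}(\mathit{txDes})$ holds once the sender knows that all non-failing processors have delivered the message. By URB-termination, it eventually holds at a correct sender. - *Binary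 consensus objects* $BC[k]$, $k\in\{0,\dots,n-1\}$. $BC[k]=\bot$ means inactive. $\mathsf{binPropose}(k,b)$ with $b\in\{\mathsf{True},\mathsf{False}\}$ activates $BC[k]$ and proposes $b$. $BC[k].\mathsf{result}(k)$ returns $\bot$ if there is no decision yet, and otherwise the decided value. The objects satisfy validity (a decided value was proposed), agreement, integrity (no processor decides twice) and termination (an active object at a correct processor eventually has a decision there). **Algorithm A (code for $p_i$).** There is a single multivalued consensus object $O$ (local copy $O_i$). $O=\bot$ means inactive and $O\ne\bot$ means active. The fields of $O$ are: - $v$, the proposed value; - $\mathit{proposals}[0..n-1]$; - $BC[0..n-1]$, binary consensus objects; - $\mathit{txDes}$; - the Boolean $\mathit{oneTerm}$. The symbol $\bot$ is a special non-value, and ERR (the paper's "transient error" symbol) is another special symbol. Proposable values belong to a finite set $V$ with $\bot,\text{ERR}\notin V$. Let $S(x)=\{0,\dots,x\}$ and $\mathsf K=\{k\in S(n-1): O.BC[k]\ne\bot\wedge O.BC[k].\mathsf{result}(k)=\mathsf{False}\}$. Define $\mathsf k()=\max(\{-1\}\cup\{x\in S(n-1): S(x)\subseteq\mathsf K\})$. - $\mathsf{propose}(v)$: if $v\ne\bot$ and $O=\bot$, then $O.(v,\mathit{proposals},BC,\mathit{txDes},\mathit{oneTerm})\gets(v,[\bot,\dots,\bot],[\bot,\dots,\bot],\bot,\mathsf{False})$. - $\mathsf{result}()$, with $k=\mathsf k()$: if $O=\bot$ return $\bot$; else if $O.v=\bot$ or $k\ge n-1$ return ERR; else if $BC[k+1]=\bot$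 or $BC[k+1].\mathsf{result}(k+1)\ne\mathsf{True}$ return $\bot$; else if $O.\mathit{proposals}[k+1]=\bot$ return ERR; else return $O.\mathit{proposals}[k+1]$. - *Do forever*, whenever $O\ne\bot$: (1) if $v\ne\bot$ and ($\mathit{txDes}=\bot$ or $\mathsf{hasTerminated}(\mathit{txDes})$), then set $\mathit{oneTerm}\gets\mathit{oneTerm}\vee(\mathit{txDes}\ne\bot\wedge\mathsf{hasTerminated}(\mathit{txDes}))$ and then $\mathit{txDes}\gets\mathsf{urbBroadcast}\ \mathrm{PROPOSAL}(v)$; (2) use one of two variants. *Sequential*: with $k=\mathsf k()$, if $\mathit{oneTerm}$, $k<n-1$, $BC[k+1]=\bot$ and ($k=-1$ or $BC[k].\mathsf{result}(k)\ne\bot$), then call $\mathsf{binPropose}(k+1,\ \mathit{proposals}[k+1]\ne\bot)$. *Concurrent*: if $\mathit{oneTerm}$ and some $BC[\ell]=\bot$, then for each $k\in\{0,\dots,n-1\}$ with $BC[k]=\bot$ call $\mathsf{binPropose}(k,\ \mathit{proposals}[k]\ne\bot)$. - *Upon URB-delivery of* $\mathrm{PROPOSAL}(v_J)$ *from* $p_j$ with $v_J\ne\bot$: if $O\ne\bot$ and $O.\mathit{proposals}[j]=\bot$, then $O.\mathit{proposals}[j]\gets v_J$; else if $O=\bot$, activate $O$ with $O.(v,\mathit{proposals},BC,\mathit{txDes},\mathit{oneTerm})\gets(v_J,[\bot,\dots,\bot],[\bot,\dots,\bot],\bot,\mathsf{False})$ and then $O.\mathit{proposals}[j]\gets v_J$.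 The statement is for either variant of (2). **Authentic executions.** A system state is *completely free* of PROPOSAL messages if the channels contain no PROPOSAL messages and no non-failing processor has an active object (all $O_i=\bot$). An invocation of $\mathsf{propose}$ by $p_i$ in which $O_i$ becomes active, taken immediately after a completely free state, is authentic. A PROPOSAL transmission by a processor following its authentic invocation is authentic. An arrival of a PROPOSAL message is authentic if it is due to an authentic transmission. If $p_j$ activates $O_j$ because of an authentic arrival (rather than by a call to $\mathsf{propose}$), this also counts as an authentic invocation by $p_j$. These notions are closed transitively. $R$ is *authentic* if it starts in a completely free state and, for every $p_k\in\mathcal P$, every invocation of $\mathsf{propose}_k$ in $R$ and every transmission and reception of PROPOSAL messages from or to $p_k$ is authentic, i.e., all PROPOSAL activity in $R$ originates from invocations of $\mathsf{propose}$ in $R$ and not from stale initial information. *)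

theory Defs
  imports Main
begin

section \<open>Local state\<close>

text \<open>
  Processors are the natural numbers below \<open>n\<close>. The non-value bottom is rendered as \<open>None\<close>, so
  proposable values are the elements of a (finite) type \<open>'v\<close>; the error symbol is a constructor
  of the return type of \<open>result\<close> and hence not a proposable value.
\<close>

datatype 'v outcome = Bot | Err | Val 'v

datatype variant = Sequential | Concurrent

text \<open>
  Position inside the current iteration of the do-forever loop: \<open>Part1\<close> and \<open>Part2\<close> are the two
  parts of the body, and \<open>For k\<close> is the point of the concurrent variant's inner loop where index
  \<open>k\<close> is examined. An atomic step performs at most one operation on a building block, so
  deliveries, decisions and crashes may occur between any two such operations.
\<close>

datatype pos = Part1 | Part2 | For nat

text \<open>
  \<open>BC O k = None\<close>: \<open>BC[k]\<close> is inactive; \<open>Some None\<close>: active and undecided;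
  \<open>Some (Some b)\<close>: decided \<open>b\<close>. Descriptors are natural numbers. The position \<open>pc\<close> is kept
  in the object because the loop body is executed only while there is an active object; a new
  object starts with a new iteration.
\<close>

record 'v obj =
  pval :: "'v option"
  proposals :: "nat \<Rightarrow> 'v option"
  BC :: "nat \<Rightarrow> bool option option"
  txDes :: "nat option"
  oneTerm :: bool
  pc :: pos

definition bc_result :: "bool option option \<Rightarrow> bool option" where
  "bc_result B = (case B of None \<Rightarrow> None | Some r \<Rightarrow> r)"

definition new_obj :: "'v option \<Rightarrow> 'v obj" where
  "new_obj w = \<lparr>pval = w, proposals = (\<lambda>_. None), BC = (\<lambda>_. None), txDes = None,
                oneTerm = False, pc = Part1\<rparr>"

definition decided_False :: "nat \<Rightarrow> 'v obj \<Rightarrow> nat set" where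
  "decided_False n O' = {k. k < n \<and> BC O' k \<noteq> None \<and> bc_result (BC O' k) = Some False}"

definition kfun :: "nat \<Rightarrow> 'v obj \<Rightarrow> int" where
  "kfun n O' = Max ({-1} \<union> int ` {x. x < n \<and> {0..x} \<subseteq> decided_False n O'})"

definition result :: "nat \<Rightarrow> 'v obj option \<Rightarrow> 'v outcome" where
  "result n Oi = (case Oi of None \<Rightarrow> Bot | Some O' \<Rightarrow>
     (let k = kfun n O'; k1 = nat (k + 1) in
      if pval O' = None \<or> k \<ge> int n - 1 then Err
      else if BC O' k1 = None \<or> bc_result (BC O' k1) \<noteq> Some True then Bot
      else (case proposals O' k1 of None \<Rightarrow> Err | Some w \<Rightarrow> Val w)))"


section \<open>System states and atomic steps\<close>

record 'v msg =
  src :: nat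
  payload :: "'v option"
  des :: nat

text \<open>
  \<open>chan\<close> holds the PROPOSAL messages present in the communication layer, i.e. in the channels
  and in the buffers of the broadcast service running on them. \<open>hasTerminated\<close> is the predicate
  offered by the broadcast service; a descriptor is held only by the sender of its message, so
  the predicate needs no processor argument.
\<close>

record 'v state =
  obj :: "nat \<Rightarrow> 'v obj option"
  crashed :: "nat set"
  chan :: "'v msg set"
  hasTerminated :: "nat \<Rightarrow> bool"

text \<open>
  \<open>Propose\<close> is a call of \<open>propose\<close>. \<open>UrbBroadcast\<close>, \<open>BinPropose\<close> and \<open>Local\<close> are the steps of
  the do-forever loop. \<open>BinDecide i k b\<close> makes the decision \<open>b\<close> of \<open>BC[k]\<close> available at \<open>i\<close>.
  \<open>Env\<close> is an internal step of the communication layer.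
\<close>

datatype 'v event =
    Crash nat
  | Propose nat "'v option"
  | UrbBroadcast nat "'v msg"
  | BinPropose nat nat bool
  | Local nat
  | UrbDeliver nat "'v msg"
  | BinDecide nat nat bool
  | Env

definition set_obj :: "nat \<Rightarrow> 'v obj option \<Rightarrow> 'v state \<Rightarrow> 'v state" where
  "set_obj i x \<sigma> = \<sigma>\<lparr>obj := (obj \<sigma>)(i := x)\<rparr>"

definition after_propose :: "'v option \<Rightarrow> 'v obj option \<Rightarrow> 'v obj option" where
  "after_propose w Oi = (if w \<noteq> None \<and> Oi = None then Some (new_obj w) else Oi)"

definition after_delivery :: "'v msg \<Rightarrow> 'v obj option \<Rightarrow> 'v obj option" where
  "after_delivery m Oi =
    (if payload m = None then Oi else
     (case Oi of
        Some O' \<Rightarrow>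
          if proposals O' (src m) = None
          then Some (O'\<lparr>proposals := (proposals O')(src m := payload m)\<rparr>) else Some O'
      | None \<Rightarrow>
          (let O' = new_obj (payload m)
           in Some (O'\<lparr>proposals := (proposals O')(src m := payload m)\<rparr>))))"

definition tx_terminated :: "'v state \<Rightarrow> 'v obj \<Rightarrow> bool" where
  "tx_terminated \<sigma> O' = (\<exists>d. txDes O' = Some d \<and> hasTerminated \<sigma> d)"

definition guard1 :: "'v state \<Rightarrow> 'v obj \<Rightarrow> bool" where
  "guard1 \<sigma> O' = (pval O' \<noteq> None \<and> (txDes O' = None \<or> tx_terminated \<sigma> O'))"

definition guard2_seq :: "nat \<Rightarrow> 'v obj \<Rightarrow> bool" where
  "guard2_seq n O' =
    (let k = kfun n O' in
       oneTerm O' \<and> k < int n - 1 \<and> BC O' (nat (k + 1)) = None \<and>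
       (k = -1 \<or> bc_result (BC O' (nat k)) \<noteq> None))"

definition guard2_conc :: "nat \<Rightarrow> 'v obj \<Rightarrow> bool" where
  "guard2_conc n O' = (oneTerm O' \<and> (\<exists>l<n. BC O' l = None))"

definition next_pos :: "nat \<Rightarrow> nat \<Rightarrow> pos" where
  "next_pos n k = (if Suc k < n then For (Suc k) else Part1)"

inductive step :: "variant \<Rightarrow> nat \<Rightarrow> 'v state \<Rightarrow> 'v event \<Rightarrow> 'v state \<Rightarrow> bool"
  for A :: variant and n :: nat where
  crash: "\<lbrakk>i < n; i \<notin> crashed \<sigma>\<rbrakk>
    \<Longrightarrow> step A n \<sigma> (Crash i) (\<sigma>\<lparr>crashed := insert i (crashed \<sigma>)\<rparr>)"
| propose: "\<lbrakk>i < n; i \<notin> crashed \<sigma>\<rbrakk>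
    \<Longrightarrow> step A n \<sigma> (Propose i w) (set_obj i (after_propose w (obj \<sigma> i)) \<sigma>)"
| part1: "\<lbrakk>i < n; i \<notin> crashed \<sigma>; obj \<sigma> i = Some O'; pc O' = Part1; guard1 \<sigma> O';
      m = \<lparr>src = i, payload = pval O', des = d\<rparr>\<rbrakk>
    \<Longrightarrow> step A n \<sigma> (UrbBroadcast i m)
         ((set_obj i (Some (O'\<lparr>oneTerm := oneTerm O' \<or> tx_terminated \<sigma> O',
                              txDes := Some d, pc := Part2\<rparr>)) \<sigma>)
          \<lparr>chan := insert m (chan \<sigma>)\<rparr>)"
| part1_skip: "\<lbrakk>i < n; i \<notin> crashed \<sigma>; obj \<sigma> i = Some O'; pc O' = Part1; \<not> guard1 \<sigma> O'\<rbrakk>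
    \<Longrightarrow> step A n \<sigma> (Local i) (set_obj i (Some (O'\<lparr>pc := Part2\<rparr>)) \<sigma>)"
| seq: "\<lbrakk>A = Sequential; i < n; i \<notin> crashed \<sigma>; obj \<sigma> i = Some O'; pc O' = Part2;
      guard2_seq n O'; k = nat (kfun n O' + 1)\<rbrakk>
    \<Longrightarrow> step A n \<sigma> (BinPropose i k (proposals O' k \<noteq> None))
         (set_obj i (Some (O'\<lparr>BC := (BC O')(k := Some None), pc := Part1\<rparr>)) \<sigma>)"
| seq_skip: "\<lbrakk>A = Sequential; i < n; i \<notin> crashed \<sigma>; obj \<sigma> i = Some O'; pc O' = Part2;
      \<not> guard2_seq n O'\<rbrakk>
    \<Longrightarrow> step A n \<sigma> (Local i) (set_obj i (Some (O'\<lparr>pc := Part1\<rparr>)) \<sigma>)"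
| conc_enter: "\<lbrakk>A = Concurrent; i < n; i \<notin> crashed \<sigma>; obj \<sigma> i = Some O'; pc O' = Part2\<rbrakk>
    \<Longrightarrow> step A n \<sigma> (Local i)
         (set_obj i (Some (O'\<lparr>pc := (if guard2_conc n O' then For 0 else Part1)\<rparr>)) \<sigma>)"
| conc: "\<lbrakk>A = Concurrent; i < n; i \<notin> crashed \<sigma>; obj \<sigma> i = Some O'; pc O' = For k;
      BC O' k = None\<rbrakk>
    \<Longrightarrow> step A n \<sigma> (BinPropose i k (proposals O' k \<noteq> None))
         (set_obj i (Some (O'\<lparr>BC := (BC O')(k := Some None), pc := next_pos n k\<rparr>)) \<sigma>)"
| conc_skip: "\<lbrakk>A = Concurrent; i < n; i \<notin> crashed \<sigma>; obj \<sigma> i = Some O'; pc O' = For k;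
      BC O' k \<noteq> None\<rbrakk>
    \<Longrightarrow> step A n \<sigma> (Local i) (set_obj i (Some (O'\<lparr>pc := next_pos n k\<rparr>)) \<sigma>)"
| inactive: "\<lbrakk>i < n; i \<notin> crashed \<sigma>; obj \<sigma> i = None\<rbrakk> \<Longrightarrow> step A n \<sigma> (Local i) \<sigma>"
| deliver: "\<lbrakk>i < n; i \<notin> crashed \<sigma>\<rbrakk>
    \<Longrightarrow> step A n \<sigma> (UrbDeliver i m) (set_obj i (after_delivery m (obj \<sigma> i)) \<sigma>)"
| decide: "\<lbrakk>i < n; i \<notin> crashed \<sigma>; obj \<sigma> i = Some O'; BC O' k \<noteq> None\<rbrakk>
    \<Longrightarrow> step A n \<sigma> (BinDecide i k b)
         (set_obj i (Some (O'\<lparr>BC := (BC O')(k := Some (Some b))\<rparr>)) \<sigma>)"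
| env: "\<lbrakk>C \<subseteq> chan \<sigma>; \<forall>d. hasTerminated \<sigma> d \<longrightarrow> T d\<rbrakk>
    \<Longrightarrow> step A n \<sigma> Env (\<sigma>\<lparr>chan := C, hasTerminated := T\<rparr>)"


section \<open>Executions\<close>

text \<open>Step \<open>event_at R s\<close> leads from \<open>state_at R s\<close> to \<open>state_at R (Suc s)\<close>.\<close>

record 'v execution =
  state_at :: "nat \<Rightarrow> 'v state"
  event_at :: "nat \<Rightarrow> 'v event"

definition Correct :: "nat \<Rightarrow> 'v execution \<Rightarrow> nat set" where
  "Correct n R = {i. i < n \<and> (\<forall>s. i \<notin> crashed (state_at R s))}"

definition loop_step :: "nat \<Rightarrow> 'v event \<Rightarrow> bool" where
  "loop_step i e = (e = Local i \<or> (\<exists>m. e = UrbBroadcast i m) \<or> (\<exists>k b. e = BinPropose i k b))"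

text \<open>
  Besides following the algorithm from an arbitrary first state, an execution lets every correct
  processor execute its do-forever loop forever. Speeds and delays are otherwise unconstrained.
\<close>

definition execution_of :: "variant \<Rightarrow> nat \<Rightarrow> 'v execution \<Rightarrow> bool" where
  "execution_of A n R =
    ((\<forall>s. step A n (state_at R s) (event_at R s) (state_at R (Suc s))) \<and>
     (\<forall>i \<in> Correct n R. infinite {s. loop_step i (event_at R s)}))"


section \<open>Uniform reliable broadcast\<close>

text \<open>A delivered message is in the communication layer, which is filled by broadcasts only.\<close>

definition urb_validity :: "'v execution \<Rightarrow> bool" where
  "urb_validity R = (\<forall>s j m. event_at R s = UrbDeliver j m \<longrightarrow> m \<in> chan (state_at R s))"

definition urb_integrity :: "'v execution \<Rightarrow> bool" where
  "urb_integrity R = (\<forall>s s' j m. event_at R s = UrbDeliver j m \<and> event_at R s' = UrbDeliver j m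
     \<longrightarrow> s = s')"

definition urb_termination :: "nat \<Rightarrow> 'v execution \<Rightarrow> bool" where
  "urb_termination n R = (\<forall>m.
     (\<exists>i \<in> Correct n R. \<exists>s. event_at R s = UrbBroadcast i m) \<or>
     (\<exists>j s. event_at R s = UrbDeliver j m)
     \<longrightarrow> (\<forall>j \<in> Correct n R. \<exists>s. event_at R s = UrbDeliver j m))"

text \<open>A descriptor identifies one invocation of the broadcast.\<close>

definition urb_descriptors :: "'v execution \<Rightarrow> bool" where
  "urb_descriptors R = (\<forall>s s' i i' m m'.
     event_at R s = UrbBroadcast i m \<and> event_at R s' = UrbBroadcast i' m' \<and> des m = des m'
     \<longrightarrow> s = s')"

text \<open>
  The non-failing processors in a state are those that have not crashed so far. (If processors
  that crash only later were exempted here, all binary objects could decide \<open>False\<close>: such a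
  processor may miss the proposals of all the others and still take part in the binary objects.)
\<close>

definition hasTerminated_sound :: "nat \<Rightarrow> 'v execution \<Rightarrow> bool" where
  "hasTerminated_sound n R = (\<forall>s0 s i m.
     event_at R s0 = UrbBroadcast i m \<and> s0 < s \<and> hasTerminated (state_at R s) (des m)
     \<longrightarrow> (\<forall>j<n. j \<notin> crashed (state_at R s) \<longrightarrow> (\<exists>s1<s. event_at R s1 = UrbDeliver j m)))"

definition hasTerminated_eventually :: "nat \<Rightarrow> 'v execution \<Rightarrow> bool" where
  "hasTerminated_eventually n R = (\<forall>s0 m. \<forall>i \<in> Correct n R.
     event_at R s0 = UrbBroadcast i m \<longrightarrow> (\<exists>s>s0. hasTerminated (state_at R s) (des m)))"

definition urb_spec :: "nat \<Rightarrow> 'v execution \<Rightarrow> bool" where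
  "urb_spec n R =
    (urb_validity R \<and> urb_integrity R \<and> urb_termination n R \<and> urb_descriptors R \<and>
     hasTerminated_sound n R \<and> hasTerminated_eventually n R)"


section \<open>Binary consensus objects\<close>

definition bc_validity :: "'v execution \<Rightarrow> bool" where
  "bc_validity R = (\<forall>s i k b. event_at R s = BinDecide i k b
     \<longrightarrow> (\<exists>s'<s. \<exists>j. event_at R s' = BinPropose j k b))"

definition bc_agreement :: "'v execution \<Rightarrow> bool" where
  "bc_agreement R = (\<forall>s s' i j k b b'.
     event_at R s = BinDecide i k b \<and> event_at R s' = BinDecide j k b' \<longrightarrow> b = b')"

definition bc_integrity :: "'v execution \<Rightarrow> bool" where
  "bc_integrity R = (\<forall>s s' i k b b'.
     event_at R s = BinDecide i k b \<and> event_at R s' = BinDecide i k b' \<longrightarrow> s = s')"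

definition bc_termination :: "nat \<Rightarrow> 'v execution \<Rightarrow> bool" where
  "bc_termination n R = (\<forall>s k O'. \<forall>i \<in> Correct n R.
     k < n \<and> obj (state_at R s) i = Some O' \<and> BC O' k = Some None
     \<longrightarrow> (\<exists>s'\<ge>s. \<exists>b. event_at R s' = BinDecide i k b))"

definition bc_spec :: "nat \<Rightarrow> 'v execution \<Rightarrow> bool" where
  "bc_spec n R = (bc_validity R \<and> bc_agreement R \<and> bc_integrity R \<and> bc_termination n R)"


section \<open>Authentic executions\<close>

definition completely_free :: "nat \<Rightarrow> 'v state \<Rightarrow> bool" where
  "completely_free n \<sigma> = (chan \<sigma> = {} \<and> (\<forall>i<n. i \<notin> crashed \<sigma> \<longrightarrow> obj \<sigma> i = None))"

definition activates :: "'v execution \<Rightarrow> nat \<Rightarrow> nat \<Rightarrow> bool" where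
  "activates R i s = (obj (state_at R s) i = None \<and> obj (state_at R (Suc s)) i \<noteq> None)"

text \<open>
  In rule \<open>invoke\<close> the completely free state need not be the one directly before the invocation.
  If it were, then after the first invocation no other processor could call \<open>propose\<close> itself,
  contrary to the task, in which every processor proposes. Every step that is authentic in the
  narrower sense is authentic here.
\<close>

inductive authentic_invocation :: "nat \<Rightarrow> 'v execution \<Rightarrow> nat \<Rightarrow> nat \<Rightarrow> bool"
  and authentic_transmission :: "nat \<Rightarrow> 'v execution \<Rightarrow> nat \<Rightarrow> 'v msg \<Rightarrow> nat \<Rightarrow> bool"
  and authentic_arrival :: "nat \<Rightarrow> 'v execution \<Rightarrow> nat \<Rightarrow> 'v msg \<Rightarrow> nat \<Rightarrow> bool"
  for n :: nat and R :: "'v execution" where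
  invoke: "\<lbrakk>event_at R s = Propose i w; activates R i s;
      s0 \<le> s; completely_free n (state_at R s0)\<rbrakk>
    \<Longrightarrow> authentic_invocation n R i s"
| arrival_invoke: "\<lbrakk>authentic_arrival n R i m s; activates R i s\<rbrakk>
    \<Longrightarrow> authentic_invocation n R i s"
| transmission: "\<lbrakk>authentic_invocation n R i s0; s0 < s; event_at R s = UrbBroadcast i m\<rbrakk>
    \<Longrightarrow> authentic_transmission n R i m s"
| arrival: "\<lbrakk>authentic_transmission n R j m s0; s0 < s; event_at R s = UrbDeliver i m\<rbrakk>
    \<Longrightarrow> authentic_arrival n R i m s"

text \<open>
  Calls of \<open>propose\<close> that have no effect (because the object is already active or the argument is
  bottom) cause no PROPOSAL activity and are not restricted.
\<close>

definition authentic :: "nat \<Rightarrow> 'v execution \<Rightarrow> bool" where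
  "authentic n R =
    (completely_free n (state_at R 0) \<and>
     (\<forall>s i w. event_at R s = Propose i w \<and> activates R i s \<longrightarrow> authentic_invocation n R i s) \<and>
     (\<forall>s i m. event_at R s = UrbBroadcast i m \<longrightarrow> authentic_transmission n R i m s) \<and>
     (\<forall>s i m. event_at R s = UrbDeliver i m \<longrightarrow> authentic_arrival n R i m s))"


section \<open>Proposing and deciding\<close>

text \<open>The activation of an object by an arriving message counts as an invocation as well.\<close>

definition proposes :: "'v execution \<Rightarrow> nat \<Rightarrow> bool" where
  "proposes R i = (\<exists>s. (\<exists>w. event_at R s = Propose i (Some w)) \<or>
                        (\<exists>m. event_at R s = UrbDeliver i m \<and> activates R i s))"

text \<open>
  \<open>decides n R i s w\<close>: calling \<open>result\<close> at \<open>i\<close> in the \<open>s\<close>-th state returns \<open>w\<close>. A crashed processor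
  executes nothing.
\<close>

definition decides :: "nat \<Rightarrow> 'v execution \<Rightarrow> nat \<Rightarrow> nat \<Rightarrow> 'v \<Rightarrow> bool" where
  "decides n R i s w =
    (i < n \<and> i \<notin> crashed (state_at R s) \<and> result n (obj (state_at R s) i) = Val w)"

end

theory Submission
  imports Defs
begin

text \<open>
  The decided index is the least \<open>x\<close> such that \<open>BC[x]\<close> never decides \<open>False\<close>. It exists: when
  \<open>oneTerm\<close> is set for the first time anywhere, say at \<open>p\<^sub>j\<close>, every processor that has not crashed
  holds the proposal of \<open>p\<^sub>j\<close>; since binary proposals are made only after that, all those made to
  \<open>BC[j]\<close> are \<open>True\<close>. A decision \<open>True\<close> of \<open>BC[x]\<close> means that some processor had received the
  proposal of \<open>p\<^sub>x\<close>, so every correct processor eventually receives it; and it is the same value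
  everywhere because the \<open>v\<close> field of an active object never changes.
\<close>

section \<open>The first binary object not decided False\<close>

text \<open>This is \<open>k() + 1\<close> as a natural number. The least element exists because
  \<open>n\<close> is never in \<open>decided_False\<close>, and it equals \<open>n\<close> when all
  binary objects have decided False.\<close>

definition first_open :: "nat \<Rightarrow> 'v obj \<Rightarrow> nat" where
  "first_open n O' = (LEAST x. x \<notin> decided_False n O')"

lemma decided_False_iff: "k \<in> decided_False n O' \<longleftrightarrow> k < n \<and> BC O' k = Some (Some False)"
  by (auto simp: decided_False_def bc_result_def split: option.splits)

lemma first_open_eqI:
  assumes "\<And>y. y < x \<Longrightarrow> y \<in> decided_False n O'" "x \<notin> decided_False n O'"
  shows "first_open n O' = x"
  unfolding first_open_def using assms by (intro Least_equality) (auto simp: not_less[symmetric])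

lemma first_open_notin: "first_open n O' \<notin> decided_False n O'"
  unfolding first_open_def by (rule LeastI[of _ n]) (simp add: decided_False_def)

lemma less_first_open: "y < first_open n O' \<Longrightarrow> y \<in> decided_False n O'"
  unfolding first_open_def by (auto dest: not_less_Least)

lemma kfun_eq: "kfun n O' = int (first_open n O') - 1"
proof -
  let ?x = "first_open n O'"
  have *: "{0..x} \<subseteq> decided_False n O' \<longleftrightarrow> x < ?x" for x
    using first_open_notin[of n O'] less_first_open[of _ n O'] by (fastforce simp: not_less[symmetric])
  have "x < ?x \<Longrightarrow> x < n" for x
    using less_first_open[of x n O'] by (simp add: decided_False_def)
  then have "{x. x < n \<and> {0..x} \<subseteq> decided_False n O'} = {..<?x}"
    unfolding * by auto
  then have "kfun n O' = Max ({-1} \<union> int ` {..<?x})"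
    by (simp add: kfun_def)
  also have "\<dots> = int ?x - 1"
  proof (rule Max_eqI)
    show "int ?x - 1 \<in> {- 1} \<union> int ` {..<?x}"
      by (cases ?x) auto
  qed auto
  finally show ?thesis .
qed

lemma result_Some:
  "result n (Some O') =
    (let x = first_open n O' in
     if pval O' = None \<or> n \<le> x then Err
     else if BC O' x \<noteq> Some (Some True) then Bot
     else (case proposals O' x of None \<Rightarrow> Err | Some w \<Rightarrow> Val w))"
  by (auto simp: result_def Let_def kfun_eq bc_result_def split: option.splits)

lemma guard2_seq_iff:
  "guard2_seq n O' \<longleftrightarrow>
    oneTerm O' \<and> first_open n O' < n \<and> BC O' (first_open n O') = None"
proof -
  \<comment> \<open>The index just below \<open>first_open\<close> has decided False, which settles
    the conjunct of \<open>guard2_seq\<close> about the result of \<open>BC[k]\<close>.\<close>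
  have "first_open n O' \<noteq> 0 \<Longrightarrow> first_open n O' - 1 \<in> decided_False n O'"
    by (rule less_first_open) simp
  then have "first_open n O' \<noteq> 0 \<Longrightarrow> BC O' (first_open n O' - Suc 0) = Some (Some False)"
    by (simp add: decided_False_iff)
  then show ?thesis
    by (auto simp: guard2_seq_def Let_def kfun_eq bc_result_def nat_diff_distrib)
qed


section \<open>Single steps\<close>

text \<open>For binary objects only activity and the presence of a result are kept, because a
  \<open>BinDecide\<close> step by itself may overwrite one result by another; the value is fixed
  later through agreement.\<close>

definition grows :: "'v obj \<Rightarrow> 'v obj \<Rightarrow> bool" where
  "grows O1 O2 \<longleftrightarrow> pval O2 = pval O1 \<and> (oneTerm O1 \<longrightarrow> oneTerm O2) \<and>
     (\<forall>j w. proposals O1 j = Some w \<longrightarrow> proposals O2 j = Some w) \<and>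
     (\<forall>k. BC O1 k \<noteq> None \<longrightarrow> BC O2 k \<noteq> None) \<and>
     (\<forall>k. bc_result (BC O1 k) \<noteq> None \<longrightarrow> bc_result (BC O2 k) \<noteq> None)"

lemma grows_refl: "grows O1 O1"
  by (simp add: grows_def)

lemma grows_trans: "grows O1 O2 \<Longrightarrow> grows O2 O3 \<Longrightarrow> grows O1 O3"
  by (auto simp: grows_def)

lemma grows_decided:
  assumes "grows O1 O2" "BC O1 k = Some (Some b)"
  shows "\<exists>b'. BC O2 k = Some (Some b')"
proof -
  have "bc_result (BC O1 k) \<noteq> None"
    using assms(2) by (simp add: bc_result_def)
  then have "bc_result (BC O2 k) \<noteq> None"
    using assms(1) by (auto simp: grows_def)
  then show ?thesis by (auto simp: bc_result_def split: option.splits)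
qed

lemma step_grows:
  assumes "step A n \<sigma> e \<sigma>'" "obj \<sigma> i = Some O1"
  shows "\<exists>O2. obj \<sigma>' i = Some O2 \<and> grows O1 O2"
  using assms
proof cases
  case (seq i' O' k)
  \<comment> \<open>Proposing writes \<open>Some None\<close>, which would erase a decision; the
    guard ensures that the entry is still inactive.\<close>
  then have "BC O' k = None"
    by (simp add: guard2_seq_iff kfun_eq)
  with seq assms show ?thesis
    by (auto simp: set_obj_def grows_def bc_result_def)
qed (auto simp: set_obj_def grows_def bc_result_def after_propose_def after_delivery_def
       split: option.splits)

lemma step_crashed_mono: "step A n \<sigma> e \<sigma>' \<Longrightarrow> crashed \<sigma> \<subseteq> crashed \<sigma>'"
  by (induction rule: step.induct) (auto simp: set_obj_def)

lemma step_hasTerminated_mono: "step A n \<sigma> e \<sigma>' \<Longrightarrow> hasTerminated \<sigma> d \<Longrightarrow> hasTerminated \<sigma>' d"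
  by (induction rule: step.induct) (auto simp: set_obj_def)

lemma step_broadcast:
  assumes "step A n \<sigma> (UrbBroadcast i m) \<sigma>'"
  shows "i < n \<and> i \<notin> crashed \<sigma> \<and> src m = i \<and>
    (\<exists>O1. obj \<sigma> i = Some O1 \<and> payload m = pval O1 \<and> pval O1 \<noteq> None)"
  using assms by cases (auto simp: guard1_def)

lemma step_chan:
  assumes "step A n \<sigma> e \<sigma>'" "m \<in> chan \<sigma>'"
  shows "m \<in> chan \<sigma> \<or> e = UrbBroadcast (src m) m"
  using assms by cases (auto simp: set_obj_def)

lemma step_deliver:
  assumes "step A n \<sigma> (UrbDeliver i m) \<sigma>'" "payload m = Some w"
  shows "i < n \<and> i \<notin> crashed \<sigma> \<and>
    (\<exists>O2. obj \<sigma>' i = Some O2 \<and> proposals O2 (src m) \<noteq> None)"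
  using assms by cases (auto simp: set_obj_def after_delivery_def Let_def split: option.splits)

lemma step_decide:
  assumes "step A n \<sigma> (BinDecide i k b) \<sigma>'"
  shows "\<exists>O2. obj \<sigma>' i = Some O2 \<and> BC O2 k = Some (Some b)"
  using assms by cases (auto simp: set_obj_def)

text \<open>The inner loop of the concurrent variant tests \<open>oneTerm\<close> only on entry, so
  a single step yields just the position \<open>For k\<close>; the invariant \<open>traced\<close>
  turns this into \<open>oneTerm\<close>.\<close>

lemma step_binPropose:
  assumes "step A n \<sigma> (BinPropose i k b) \<sigma>'"
  shows "\<exists>O1. i < n \<and> i \<notin> crashed \<sigma> \<and> obj \<sigma> i = Some O1 \<and>
    (oneTerm O1 \<or> pc O1 = For k) \<and> b = (proposals O1 k \<noteq> None)"
  using assms by cases (auto simp: guard2_seq_def Let_def)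

lemma step_activate:
  assumes "step A n \<sigma> e \<sigma>'" "obj \<sigma> i = None" "obj \<sigma>' i = Some O2"
  shows "i < n \<and> pval O2 \<noteq> None \<and>
    (e = Propose i (pval O2) \<or> (\<exists>m. e = UrbDeliver i m \<and> payload m = pval O2))"
  using assms
  by cases (auto simp: set_obj_def after_propose_def after_delivery_def new_obj_def Let_def
      split: if_splits option.splits)

lemma step_oneTerm_set:
  assumes "step A n \<sigma> e \<sigma>'" "obj \<sigma>' i = Some O2" "oneTerm O2"
    "\<And>O1. obj \<sigma> i = Some O1 \<Longrightarrow> \<not> oneTerm O1"
  shows "\<exists>O1. obj \<sigma> i = Some O1 \<and> tx_terminated \<sigma> O1"
  using assms
  by cases (auto simp: set_obj_def after_propose_def after_delivery_def new_obj_def Let_def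
      split: if_splits option.splits)

text \<open>A descriptor is replaced only by a new broadcast, whose guard then requires the old one
  to have terminated, and the same step sets \<open>oneTerm\<close>.\<close>

lemma step_txDes:
  assumes "step A n \<sigma> e \<sigma>'" "obj \<sigma> i = Some O1" "txDes O1 = Some d" "obj \<sigma>' i = Some O2"
  shows "oneTerm O2 \<or> txDes O2 = Some d"
  using assms
  by cases (auto simp: set_obj_def after_propose_def after_delivery_def guard1_def Let_def
      split: if_splits option.splits)

lemma step_no_loop_pc:
  assumes "step A n \<sigma> e \<sigma>'" "obj \<sigma> i = Some O1" "\<not> loop_step i e"
  shows "\<exists>O2. obj \<sigma>' i = Some O2 \<and> pc O2 = pc O1"
  using assms
  by cases (auto simp: set_obj_def after_propose_def after_delivery_def loop_step_def Let_def
      split: if_splits option.splits)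

lemma step_loop_Part1:
  assumes "step A n \<sigma> e \<sigma>'" "obj \<sigma> i = Some O1" "loop_step i e" "pc O1 = Part1"
  shows "\<exists>O2. obj \<sigma>' i = Some O2 \<and> pc O2 = Part2 \<and>
    (guard1 \<sigma> O1 \<longrightarrow> txDes O2 \<noteq> None) \<and> (guard1 \<sigma> O1 \<and> tx_terminated \<sigma> O1 \<longrightarrow> oneTerm O2)"
  using assms by cases (auto simp: set_obj_def loop_step_def)

lemma step_loop_Part2:
  assumes "step A n \<sigma> e \<sigma>'" "obj \<sigma> i = Some O1" "loop_step i e" "pc O1 = Part2"
  shows "\<exists>O2. obj \<sigma>' i = Some O2 \<and>
    (case A of
       Sequential \<Rightarrow> pc O2 = Part1 \<and> (guard2_seq n O1 \<longrightarrow> BC O2 (first_open n O1) \<noteq> None)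
     | Concurrent \<Rightarrow> pc O2 = (if guard2_conc n O1 then For 0 else Part1))"
  using assms by cases (auto simp: set_obj_def loop_step_def kfun_eq)

lemma step_loop_For:
  assumes "step A n \<sigma> e \<sigma>'" "obj \<sigma> i = Some O1" "loop_step i e" "pc O1 = For k"
  shows "\<exists>O2. obj \<sigma>' i = Some O2 \<and> pc O2 = next_pos n k \<and> BC O2 k \<noteq> None"
  using assms by cases (auto simp: set_obj_def loop_step_def)

section \<open>Origin of the contents of an object in earlier events\<close>

lemma step_txDes_from:
  assumes "step A n \<sigma> e \<sigma>'" "obj \<sigma>' i = Some O2" "txDes O2 = Some d"
  shows "(\<exists>O1. obj \<sigma> i = Some O1 \<and> txDes O1 = Some d) \<or> (\<exists>m. e = UrbBroadcast i m \<and> des m = d)"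
  using assms
  by cases (auto simp: set_obj_def after_propose_def after_delivery_def new_obj_def Let_def
      split: if_splits option.splits)

lemma step_proposals_from:
  assumes "step A n \<sigma> e \<sigma>'" "obj \<sigma>' i = Some O2" "proposals O2 j = Some w"
  shows "(\<exists>O1. obj \<sigma> i = Some O1 \<and> proposals O1 j = Some w) \<or>
    (\<exists>m. e = UrbDeliver i m \<and> src m = j \<and> payload m = Some w)"
  using assms
  by cases (auto simp: set_obj_def after_propose_def after_delivery_def new_obj_def Let_def
      split: if_splits option.splits)

lemma step_BC_from:
  assumes "step A n \<sigma> e \<sigma>'" "obj \<sigma>' i = Some O2" "BC O2 k = Some (Some b)"
  shows "(\<exists>O1. obj \<sigma> i = Some O1 \<and> BC O1 k = Some (Some b)) \<or> e = BinDecide i k b"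
  using assms
  by cases (auto simp: set_obj_def after_propose_def after_delivery_def new_obj_def Let_def
      split: if_splits option.splits)

text \<open>The second alternative is a predecessor that violates the property to be shown, so an
  induction over the states excludes it.\<close>

lemma step_For_from:
  assumes "step A n \<sigma> e \<sigma>'" "obj \<sigma>' i = Some O2" "pc O2 = For k"
  shows "oneTerm O2 \<or> (\<exists>O1 k'. obj \<sigma> i = Some O1 \<and> pc O1 = For k' \<and> \<not> oneTerm O1)"
  using assms
  by cases (auto simp: set_obj_def after_propose_def after_delivery_def new_obj_def Let_def
      guard2_conc_def split: if_splits option.splits)

text \<open>An invariant for processors that start without an object: every entry that could
  otherwise be stale is backed by an earlier event of the same processor.\<close>

definition traced :: "'v execution \<Rightarrow> nat \<Rightarrow> nat \<Rightarrow> 'v obj \<Rightarrow> bool" where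
  "traced R s i O' \<longleftrightarrow>
     pval O' \<noteq> None \<and>
     (\<forall>k. pc O' = For k \<longrightarrow> oneTerm O') \<and>
     (\<forall>d. txDes O' = Some d \<longrightarrow> (\<exists>s'<s. \<exists>m. event_at R s' = UrbBroadcast i m \<and> des m = d)) \<and>
     (\<forall>j w. proposals O' j = Some w \<longrightarrow>
        (\<exists>s'<s. \<exists>m. event_at R s' = UrbDeliver i m \<and> src m = j \<and> payload m = Some w)) \<and>
     (\<forall>k b. BC O' k = Some (Some b) \<longrightarrow> (\<exists>s'<s. event_at R s' = BinDecide i k b))"

lemma tracedD:
  assumes "traced R s i O'"
  shows "pval O' \<noteq> None"
    and "pc O' = For k \<Longrightarrow> oneTerm O'"
    and "txDes O' = Some d \<Longrightarrow> \<exists>s'<s. \<exists>m. event_at R s' = UrbBroadcast i m \<and> des m = d"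
    and "proposals O' j = Some w \<Longrightarrow>
      \<exists>s'<s. \<exists>m. event_at R s' = UrbDeliver i m \<and> src m = j \<and> payload m = Some w"
    and "BC O' l = Some (Some b) \<Longrightarrow> \<exists>s'<s. event_at R s' = BinDecide i l b"
  using assms unfolding traced_def by simp_all

lemma traced_step:
  assumes st: "step A n (state_at R s) (event_at R s) (state_at R (Suc s))"
    and IH: "\<And>O1. obj (state_at R s) i = Some O1 \<Longrightarrow> traced R s i O1"
    and O2: "obj (state_at R (Suc s)) i = Some O2"
  shows "traced R (Suc s) i O2"
proof -
  have "pval O2 \<noteq> None"
  proof (cases "obj (state_at R s) i")
    case None
    then show ?thesis using step_activate[OF st _ O2] by blast
  next
    case (Some O1)
    then show ?thesis using step_grows[OF st Some] IH[OF Some] O2 by (auto simp: grows_def traced_def)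
  qed
  moreover have "oneTerm O2" if "pc O2 = For k" for k
    using step_For_from[OF st O2 that] tracedD(2)[OF IH] by blast
  moreover have "\<exists>s'<Suc s. \<exists>m. event_at R s' = UrbBroadcast i m \<and> des m = d"
    if "txDes O2 = Some d" for d
    using step_txDes_from[OF st O2 that] tracedD(3)[OF IH] by (blast intro: less_SucI)
  moreover have "\<exists>s'<Suc s. \<exists>m. event_at R s' = UrbDeliver i m \<and> src m = j \<and> payload m = Some w"
    if "proposals O2 j = Some w" for j w
    using step_proposals_from[OF st O2 that] tracedD(4)[OF IH] by (blast intro: less_SucI)
  moreover have "\<exists>s'<Suc s. event_at R s' = BinDecide i k b" if "BC O2 k = Some (Some b)" for k b
    using step_BC_from[OF st O2 that] tracedD(5)[OF IH] by (blast intro: less_SucI)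
  ultimately show ?thesis by (simp add: traced_def)
qed


section \<open>Safety\<close>

locale run =
  fixes R :: "'v execution" and A :: variant and n :: nat
  assumes exec: "execution_of A n R"
    and urb: "urb_spec n R"
    and bc: "bc_spec n R"
    and free: "completely_free n (state_at R 0)"
begin

abbreviation ob :: "nat \<Rightarrow> nat \<Rightarrow> 'v obj option" where
  "ob s i \<equiv> obj (state_at R s) i"

text \<open>A processor crashed in the first state may hold an arbitrary stale object, as
  \<open>completely_free\<close> does not restrict it. The invariants concern all others, including
  those that crash later.\<close>

definition live :: "nat \<Rightarrow> bool" where
  "live i \<longleftrightarrow> i < n \<and> i \<notin> crashed (state_at R 0)"

text \<open>By agreement a decision depends on the binary object alone, so it is recorded without
  the processor.\<close>

definition dec :: "nat \<Rightarrow> bool \<Rightarrow> bool" where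
  "dec k b \<longleftrightarrow> (\<exists>s i. event_at R s = BinDecide i k b)"

lemma stepR: "step A n (state_at R s) (event_at R s) (state_at R (Suc s))"
  using exec by (simp add: execution_of_def)

lemma crashed_mono: "s \<le> s' \<Longrightarrow> crashed (state_at R s) \<subseteq> crashed (state_at R s')"
  by (rule lift_Suc_mono_le[of "\<lambda>s. crashed (state_at R s)"]) (use stepR step_crashed_mono in blast)

lemma liveI: "i < n \<Longrightarrow> i \<notin> crashed (state_at R s) \<Longrightarrow> live i"
  using crashed_mono[of 0 s] by (auto simp: live_def)

lemma Correct_live: "i \<in> Correct n R \<Longrightarrow> live i"
  by (auto simp: Correct_def live_def)

lemma ob_0: "live i \<Longrightarrow> ob 0 i = None"
  using free by (auto simp: completely_free_def live_def)

lemma grows_le: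
  assumes "s \<le> s'" "ob s i = Some O1"
  shows "\<exists>O2. ob s' i = Some O2 \<and> grows O1 O2"
  using assms(1)
proof (induction rule: dec_induct)
  case base
  then show ?case using assms(2) grows_refl by blast
next
  case (step s')
  then show ?case using step_grows[OF stepR] grows_trans by blast
qed

lemma growsE:
  assumes "ob s i = Some O1" "s \<le> s'"
  obtains O2 where "ob s' i = Some O2" "grows O1 O2"
  using grows_le assms by blast

lemma traced:
  assumes "live i" "ob s i = Some O1"
  shows "traced R s i O1"
  using assms(2)
proof (induction s arbitrary: O1)
  case 0
  then show ?case using ob_0[OF assms(1)] by simp
next
  case (Suc s)
  show ?case by (rule traced_step[OF stepR Suc.IH Suc.prems])
qed

text \<open>The channels start empty and only broadcasts add messages; environment steps can only
  remove them.\<close>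

lemma chan_broadcast: "m \<in> chan (state_at R s) \<Longrightarrow> \<exists>s'<s. event_at R s' = UrbBroadcast (src m) m"
proof (induction s)
  case 0
  then show ?case using free by (simp add: completely_free_def)
next
  case (Suc s)
  then show ?case using step_chan[OF stepR Suc.prems] less_Suc_eq by blast
qed

lemma broadcastD:
  assumes "event_at R s = UrbBroadcast i m"
  shows "live i" "src m = i"
    "\<exists>O1 w. ob s i = Some O1 \<and> payload m = Some w \<and> pval O1 = Some w"
  using step_broadcast[OF stepR[of s, unfolded assms]] liveI[of i s]
  by auto

lemma deliver_src:
  assumes "event_at R s = UrbDeliver i m"
  shows "\<exists>s'<s. \<exists>O1 w. live (src m) \<and> ob s' (src m) = Some O1 \<and>
    payload m = Some w \<and> pval O1 = Some w"
proof -
  have "m \<in> chan (state_at R s)"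
    using urb assms by (auto simp: urb_spec_def urb_validity_def)
  then obtain s' where "s' < s" "event_at R s' = UrbBroadcast (src m) m"
    using chan_broadcast by blast
  then show ?thesis using broadcastD by blast
qed

lemma proposals_src:
  assumes "live i" "ob s i = Some O1" "proposals O1 j = Some w"
  shows "\<exists>s'<s. \<exists>O2. live j \<and> ob s' j = Some O2 \<and> pval O2 = Some w"
proof -
  obtain s1 m where 1: "s1 < s" "event_at R s1 = UrbDeliver i m" "src m = j" "payload m = Some w"
    using tracedD(4)[OF traced[OF assms(1,2)] assms(3)] by blast
  obtain s2 O2 where "s2 < s1" "live j" "ob s2 j = Some O2" "pval O2 = Some w"
    using deliver_src[OF 1(2)] 1(3,4) by auto
  with 1(1) show ?thesis by (meson less_trans)
qed

text \<open>Objects never disappear and \<open>grows\<close> preserves \<open>pval\<close>. Hence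
  all messages of one sender carry the same value, which makes entries at different processors
  comparable.\<close>

lemma pval_unique:
  assumes "ob s i = Some O1" "ob s' i = Some O2"
  shows "pval O1 = pval O2"
  using assms
proof (induction s s' arbitrary: O1 O2 rule: linorder_wlog)
  case (le a b)
  then show ?case using grows_le[of a b i O1] by (auto simp: grows_def)
next
  case (sym a b)
  then show ?case by metis
qed

text \<open>The value is followed backwards in time: to the preceding state, to a call of
  \<open>propose\<close>, or to the sender of the activating message. The sender held it in an
  earlier state, hence the strong induction with arbitrary processor.\<close>

lemma pval_proposed:
  assumes "live i" "ob s i = Some O1" "pval O1 = Some w"
  shows "\<exists>j<n. \<exists>s'<s. event_at R s' = Propose j (Some w)"
  using assms
proof (induction s arbitrary: i O1 rule: less_induct)
  case (less s)
  show ?case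
  proof (cases s)
    case 0
    then show ?thesis using less.prems ob_0 by simp
  next
    case (Suc r)
    show ?thesis
    proof (cases "ob r i")
      case None
      consider "i < n" "event_at R r = Propose i (Some w)"
        | m where "event_at R r = UrbDeliver i m" "payload m = Some w"
        using step_activate[OF stepR None less.prems(2)[unfolded Suc]] less.prems(3) by auto
      then show ?thesis
      proof cases
        case 1
        then show ?thesis using Suc by blast
      next
        case 2
        then obtain s' O2 where "s' < r" "live (src m)" "ob s' (src m) = Some O2" "pval O2 = Some w"
          using deliver_src by fastforce
        then show ?thesis using less.IH[of s' "src m" O2] Suc by (meson less_SucI less_trans)
      qed
    next
      case (Some O2)
      then have "pval O2 = Some w"
        using pval_unique less.prems(2,3) by metis
      then show ?thesis
        using less.IH[OF _ less.prems(1) Some] Suc by (meson less_Suc_eq)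
    qed
  qed
qed

lemma dec_unique: "dec k b \<Longrightarrow> dec k b' \<Longrightarrow> b = b'"
  using bc unfolding dec_def bc_spec_def bc_agreement_def by blast

lemma BC_dec:
  assumes "live i" "ob s i = Some O1" "BC O1 k = Some (Some b)"
  shows "dec k b"
  using tracedD(5)[OF traced[OF assms(1,2)] assms(3)] unfolding dec_def by blast

text \<open>This replaces the local view by the global relation \<open>dec\<close>, which alone
  determines \<open>x\<close>.\<close>

lemma decidesD:
  assumes "decides n R i s w"
  shows "\<exists>O1 x. live i \<and> ob s i = Some O1 \<and> (\<forall>y<x. dec y False) \<and> dec x True \<and>
    proposals O1 x = Some w"
proof -
  have live: "live i" and res: "result n (ob s i) = Val w"
    using assms liveI by (auto simp: decides_def)
  then obtain O1 where O1: "ob s i = Some O1"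
    by (cases "ob s i") (auto simp: result_def)
  let ?x = "first_open n O1"
  have x: "BC O1 ?x = Some (Some True)" "proposals O1 ?x = Some w"
    using res by (auto simp: O1 result_Some Let_def split: if_splits option.splits)
  have "dec y False" if "y < ?x" for y
    using less_first_open[OF that] BC_dec[OF live O1] by (simp add: decided_False_iff)
  moreover have "dec ?x True" using BC_dec[OF live O1 x(1)] .
  ultimately show ?thesis
    using live O1 x(2) by (intro exI[of _ O1] exI[of _ ?x]) simp
qed

lemma decides_agree:
  assumes "decides n R i s v" "decides n R j s' v'"
  shows "v = v'"
proof -
  obtain O1 x where 1: "live i" "ob s i = Some O1" "\<forall>y<x. dec y False" "dec x True"
      "proposals O1 x = Some v"
    using decidesD[OF assms(1)] by blast
  obtain O2 y where 2: "live j" "ob s' j = Some O2" "\<forall>z<y. dec z False" "dec y True"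
      "proposals O2 y = Some v'"
    using decidesD[OF assms(2)] by blast
  \<comment> \<open>At the smaller of two different indices both False and True would have been
    decided.\<close>
  have "x = y"
    using 1(3,4) 2(3,4) dec_unique by (metis linorder_neqE_nat)
  \<comment> \<open>Both entries equal the unique \<open>pval\<close> of the processor with index
    \<open>x\<close>.\<close>
  then show ?thesis
    using proposals_src[OF 1(1,2,5)] proposals_src[OF 2(1,2,5)] pval_unique
    by (metis option.inject)
qed

lemma decides_proposed:
  assumes "decides n R i s v"
  shows "\<exists>j<n. \<exists>s'<s. event_at R s' = Propose j (Some v)"
proof -
  obtain O1 x where "live i" "ob s i = Some O1" "proposals O1 x = Some v"
    using decidesD[OF assms] by blast
  then obtain s' O2 where "s' < s" "live x" "ob s' x = Some O2" "pval O2 = Some v"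
    using proposals_src by blast
  then show ?thesis using pval_proposed by (meson less_trans)
qed


section \<open>Some binary object never decides False\<close>

lemma binProposeD:
  assumes "event_at R s = BinPropose i k b"
  shows "\<exists>O1. i < n \<and> i \<notin> crashed (state_at R s) \<and> ob s i = Some O1 \<and> oneTerm O1 \<and>
    b = (proposals O1 k \<noteq> None)"
proof -
  obtain O1 where O1: "i < n" "i \<notin> crashed (state_at R s)" "ob s i = Some O1"
      "oneTerm O1 \<or> pc O1 = For k" "b = (proposals O1 k \<noteq> None)"
    using step_binPropose[OF stepR[of s, unfolded assms]] by blast
  then have "oneTerm O1"
    using tracedD(2)[OF traced[OF liveI]] by blast
  with O1 show ?thesis by blast
qed

text \<open>Only the presence of an entry is claimed, since an earlier message of the same source
  may have filled it. Broadcast payloads are never bottom, so no delivery is ignored for lack of a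
  value.\<close>

lemma delivered_proposal:
  assumes "event_at R s1 = UrbDeliver i m" "s1 < s"
  shows "\<exists>O2. ob s i = Some O2 \<and> proposals O2 (src m) \<noteq> None"
proof -
  obtain w where "payload m = Some w"
    using deliver_src[OF assms(1)] by auto
  then obtain O1 where O1: "ob (Suc s1) i = Some O1" "proposals O1 (src m) \<noteq> None"
    using step_deliver[OF stepR[of s1, unfolded assms(1)]] by blast
  obtain O2 where "ob s i = Some O2" "grows O1 O2"
    using growsE[OF O1(1)] assms(2) by (metis Suc_leI)
  then show ?thesis using O1(2) by (auto simp: grows_def)
qed

lemma dec_proposed: "dec k b \<Longrightarrow> \<exists>s i. event_at R s = BinPropose i k b"
  using bc unfolding dec_def bc_spec_def bc_validity_def by blast

lemma never_False:
  assumes "0 < n"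
  shows "\<exists>x<n. \<not> dec x False"
proof -
  define T where "T s \<longleftrightarrow> (\<exists>i O1. live i \<and> ob s i = Some O1 \<and> oneTerm O1)" for s
  have T: "T s" if "event_at R s = BinPropose i k b" for s i k b
    using binProposeD[OF that] liveI unfolding T_def by blast
  show ?thesis
  proof (cases "\<exists>s. T s")
    case False
    \<comment> \<open>Without \<open>oneTerm\<close> no binary proposal is ever made, so by validity
      nothing is decided and index 0 serves.\<close>
    then show ?thesis using dec_proposed T assms by blast
  next
    case True
    define s where "s = (LEAST s. T s)"
    have "T s" unfolding s_def using True by (rule LeastI_ex)
    have least: "T r \<Longrightarrow> s \<le> r" for r unfolding s_def by (rule Least_le)
    obtain j O1 where j: "live j" "ob s j = Some O1" "oneTerm O1"
      using \<open>T s\<close> unfolding T_def by blast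
    obtain r where r: "s = Suc r"
      using j ob_0 by (cases s) auto
    \<comment> \<open>By minimality of \<open>s\<close>, the step from \<open>r\<close> sets
      \<open>oneTerm\<close> at \<open>j\<close>, so the broadcast of \<open>j\<close> had
      terminated in state \<open>r\<close>.\<close>
    have "\<not> T r" using least[of r] r by auto
    then obtain O0 where O0: "ob r j = Some O0" "tx_terminated (state_at R r) O0"
      using step_oneTerm_set[OF stepR j(2)[unfolded r] j(3)] j(1) unfolding T_def by blast
    then obtain d where d: "txDes O0 = Some d" "hasTerminated (state_at R r) d"
      unfolding tx_terminated_def by blast
    then obtain s0 m where m: "s0 < r" "event_at R s0 = UrbBroadcast j m" "des m = d"
      using tracedD(3)[OF traced[OF j(1) O0(1)] d(1)] by blast
    \<comment> \<open>Soundness of \<open>hasTerminated\<close> covers every processor not crashed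
      in state \<open>r\<close>, including those that crash later and may still make binary
      proposals.\<close>
    have deliv: "\<exists>s1<r. event_at R s1 = UrbDeliver i m"
      if "i < n" "i \<notin> crashed (state_at R r)" for i
      using urb m d(2) that unfolding urb_spec_def hasTerminated_sound_def by blast
    have "b" if e: "event_at R s' = BinPropose i j b" for s' i b
    proof -
      \<comment> \<open>A binary proposal presupposes \<open>oneTerm\<close>, so it cannot precede
        \<open>s\<close>; its maker is then not yet crashed in \<open>r\<close> and has the entry
        for \<open>j\<close>.\<close>
      have "r \<le> s'" using least[OF T[OF e]] r by simp
      obtain O2 where O2: "i < n" "i \<notin> crashed (state_at R s')" "ob s' i = Some O2"
          "b = (proposals O2 j \<noteq> None)"
        using binProposeD[OF e] by blast
      then obtain s1 where "s1 < r" "event_at R s1 = UrbDeliver i m"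
        using deliv crashed_mono[OF \<open>r \<le> s'\<close>] by blast
      then show b
        using delivered_proposal[of s1 i m s'] \<open>r \<le> s'\<close> O2(3,4) broadcastD(2)[OF m(2)] by auto
    qed
    then have "\<not> dec j False" using dec_proposed by blast
    moreover have "j < n" using j(1) by (simp add: live_def)
    ultimately show ?thesis by blast
  qed
qed


section \<open>Liveness\<close>

text \<open>Once the object exists, only the processor's own loop steps move its \<open>pc\<close>,
  and fairness supplies infinitely many of them.\<close>

lemma next_loop_step:
  assumes "i \<in> Correct n R" "ob s i = Some O1"
  shows "\<exists>s'\<ge>s. \<exists>O2. loop_step i (event_at R s') \<and> ob s' i = Some O2 \<and> pc O2 = pc O1"
proof -
  have "infinite {s. loop_step i (event_at R s)}"
    using exec assms(1) by (simp add: execution_of_def)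
  then obtain s1 where "loop_step i (event_at R s1)" "\<not> s1 \<le> s"
    unfolding finite_nat_set_iff_bounded_le by blast
  then obtain s1 where "s \<le> s1" "loop_step i (event_at R s1)"
    using nat_le_linear by blast
  then show ?thesis using assms(2)
  \<comment> \<open>Induction on the distance to some later loop step; the search stops at an
    earlier one if it occurs.\<close>
  proof (induction "s1 - s" arbitrary: s O1)
    case 0
    then show ?case by auto
  next
    case (Suc l)
    show ?case
    proof (cases "loop_step i (event_at R s)")
      case True
      then show ?thesis using Suc.prems by blast
    next
      case False
      then obtain O2 where O2: "ob (Suc s) i = Some O2" "pc O2 = pc O1"
        using step_no_loop_pc[OF stepR Suc.prems(3)] by blast
      show ?thesis
        using Suc.hyps(1)[OF _ _ Suc.prems(2) O2(1)] Suc.hyps(2) O2(2) by (fastforce dest: Suc_leD)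
    qed
  qed
qed

lemma reach_Part1:
  assumes "i \<in> Correct n R" "ob s i = Some O1"
  shows "\<exists>s'\<ge>s. \<exists>O2. loop_step i (event_at R s') \<and> ob s' i = Some O2 \<and> pc O2 = Part1"
  using assms(2)
\<comment> \<open>The measure bounds the remaining loop steps: \<open>Part2\<close> exceeds
  \<open>For 0\<close> by one, and the \<open>+ 1\<close> keeps every \<open>For k\<close> above
  \<open>Part1\<close>, even if \<open>k\<close> is at least \<open>n\<close>.\<close>
proof (induction "case pc O1 of Part1 \<Rightarrow> 0 | Part2 \<Rightarrow> n + 2 | For k \<Rightarrow> n - k + 1" arbitrary: s O1
    rule: less_induct)
  case less
  obtain s1 O2 where 1: "s \<le> s1" "loop_step i (event_at R s1)" "ob s1 i = Some O2" "pc O2 = pc O1"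
    using next_loop_step[OF assms(1) less.prems] by blast
  show ?case
  proof (cases "pc O1")
    case Part1
    then show ?thesis using 1 by metis
  next
    case Part2
    then obtain O3 where O3: "ob (Suc s1) i = Some O3" "pc O3 = Part1 \<or> pc O3 = For 0"
      using step_loop_Part2[OF stepR 1(3,2)] 1(4) by (cases A) (auto split: if_splits)
    then obtain s' O4 where "Suc s1 \<le> s'" "loop_step i (event_at R s')" "ob s' i = Some O4" "pc O4 = Part1"
      using less.hyps[OF _ O3(1)] Part2 by fastforce
    then show ?thesis using 1(1) by (meson Suc_leD le_trans)
  next
    case (For k)
    then obtain O3 where O3: "ob (Suc s1) i = Some O3" "pc O3 = next_pos n k"
      using step_loop_For[OF stepR 1(3,2)] 1(4) by auto
    have "(case pc O3 of Part1 \<Rightarrow> 0 | Part2 \<Rightarrow> n + 2 | For k \<Rightarrow> n - k + 1) < n - k + 1"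
      using O3(2) by (auto simp: next_pos_def)
    then obtain s' O4 where "Suc s1 \<le> s'" "loop_step i (event_at R s')" "ob s' i = Some O4" "pc O4 = Part1"
      using less.hyps[OF _ O3(1)] For by auto
    then show ?thesis using 1(1) by (meson Suc_leD le_trans)
  qed
qed

lemma reach_Part2:
  assumes "i \<in> Correct n R" "ob s i = Some O1"
  shows "\<exists>s'\<ge>s. \<exists>O2. loop_step i (event_at R s') \<and> ob s' i = Some O2 \<and> pc O2 = Part2"
proof -
  obtain s1 O2 where 1: "s \<le> s1" "loop_step i (event_at R s1)" "ob s1 i = Some O2" "pc O2 = Part1"
    using reach_Part1[OF assms] by blast
  obtain O3 where 3: "ob (Suc s1) i = Some O3" "pc O3 = Part2"
    using step_loop_Part1[OF stepR 1(3,2,4)] by blast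
  obtain s2 O4 where "Suc s1 \<le> s2" "loop_step i (event_at R s2)" "ob s2 i = Some O4" "pc O4 = Part2"
    using next_loop_step[OF assms(1) 3(1)] 3(2) by auto
  then show ?thesis using 1(1) by (meson Suc_leD le_trans)
qed

section \<open>Completion of the broadcast of a correct processor\<close>

lemma hasTerminated_mono:
  assumes "s \<le> s'" "hasTerminated (state_at R s) d"
  shows "hasTerminated (state_at R s') d"
  using assms(1) by (induction rule: dec_induct) (use assms(2) step_hasTerminated_mono stepR in blast)+

lemma eventually_txDes:
  assumes "i \<in> Correct n R" "ob s i = Some O1"
  shows "\<exists>s' O2 d. ob s' i = Some O2 \<and> txDes O2 = Some d"
proof -
  obtain s1 O2 where 1: "s \<le> s1" "loop_step i (event_at R s1)" "ob s1 i = Some O2" "pc O2 = Part1"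
    using reach_Part1[OF assms] by blast
  show ?thesis
  proof (cases "txDes O2")
    case None
    \<comment> \<open>An active object has a value, so without a descriptor the guard lets the
      broadcast happen.\<close>
    then have "guard1 (state_at R s1) O2"
      using tracedD(1)[OF traced[OF Correct_live[OF assms(1)] 1(3)]] by (simp add: guard1_def)
    then show ?thesis using step_loop_Part1[OF stepR 1(3,2,4)] by blast
  qed (use 1 in blast)
qed

lemma txDes_le:
  assumes "s \<le> s'" "ob s i = Some O1" "txDes O1 = Some d"
  shows "\<exists>O2. ob s' i = Some O2 \<and> (oneTerm O2 \<or> txDes O2 = Some d)"
  using assms(1)
proof (induction rule: dec_induct)
  case (step s')
  then obtain O2 where O2: "ob s' i = Some O2" "oneTerm O2 \<or> txDes O2 = Some d" by blast
  obtain O3 where "ob (Suc s') i = Some O3" "grows O2 O3"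
    using step_grows[OF stepR O2(1)] by blast
  then show ?case using O2 step_txDes[OF stepR O2(1)] unfolding grows_def by blast
qed (use assms in blast)

text \<open>A stored descriptor eventually reports termination. At the next \<open>Part1\<close>
  after that, either \<open>oneTerm\<close> is already set, or the descriptor is still the same and
  the step sets it.\<close>

lemma eventually_oneTerm:
  assumes "i \<in> Correct n R" "ob s i = Some O1"
  shows "\<exists>s' O2. ob s' i = Some O2 \<and> oneTerm O2"
proof -
  obtain s1 O2 d where 1: "ob s1 i = Some O2" "txDes O2 = Some d"
    using eventually_txDes[OF assms] by blast
  obtain s0 m where "s0 < s1" "event_at R s0 = UrbBroadcast i m" "des m = d"
    using tracedD(3)[OF traced[OF Correct_live[OF assms(1)] 1(1)] 1(2)] by blast
  then obtain s2 where s2: "hasTerminated (state_at R s2) d"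
    using urb assms(1) unfolding urb_spec_def hasTerminated_eventually_def by blast
  obtain O3 where "ob (max s1 s2) i = Some O3"
    using growsE[OF 1(1) max.cobounded1] by blast
  then obtain s3 O4 where 3: "max s1 s2 \<le> s3" "loop_step i (event_at R s3)"
      "ob s3 i = Some O4" "pc O4 = Part1"
    using reach_Part1[OF assms(1)] by blast
  show ?thesis
  proof (cases "oneTerm O4")
    case False
    then have "txDes O4 = Some d"
      using txDes_le[OF _ 1] 3 by fastforce
    then have "tx_terminated (state_at R s3) O4"
      using hasTerminated_mono[OF _ s2] 3(1) by (simp add: tx_terminated_def)
    moreover from this have "guard1 (state_at R s3) O4"
      using tracedD(1)[OF traced[OF Correct_live[OF assms(1)] 3(3)]] by (simp add: guard1_def)
    ultimately show ?thesis using step_loop_Part1[OF stepR 3(3,2,4)] by blast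
  qed (use 3 in blast)
qed

section \<open>Successive decisions of the binary objects at a correct processor\<close>

lemma decided_False_grows:
  assumes "live i" "ob s i = Some O1" "ob s' i = Some O2" "grows O1 O2" "k \<in> decided_False n O1"
  shows "k \<in> decided_False n O2"
proof -
  have k: "k < n" "BC O1 k = Some (Some False)"
    using assms(5) by (simp_all add: decided_False_iff)
  obtain b where b: "BC O2 k = Some (Some b)"
    using grows_decided[OF assms(4) k(2)] by blast
  \<comment> \<open>\<open>grows\<close> preserves only the presence of a result; agreement
    preserves its value.\<close>
  moreover have "b = False"
    using dec_unique BC_dec[OF assms(1,2) k(2)] BC_dec[OF assms(1,3) b] by blast
  ultimately show ?thesis using k by (simp add: decided_False_iff)
qed

text \<open>If \<open>BC[y]\<close> stayed inactive forever, \<open>first_open\<close> would remain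
  \<open>y\<close> and \<open>oneTerm\<close> would remain set, so the next \<open>Part2\<close>
  would pass its guard and activate \<open>BC[y]\<close>, in the concurrent variant through the
  inner loop.\<close>

lemma eventually_active:
  assumes i: "i \<in> Correct n R" and O1: "ob s i = Some O1" "oneTerm O1"
    and y: "y < n" "\<And>z. z < y \<Longrightarrow> z \<in> decided_False n O1"
  shows "\<exists>s' O2. ob s' i = Some O2 \<and> BC O2 y \<noteq> None"
proof (rule ccontr)
  assume "\<not> ?thesis"
  then have inact: "BC O2 y = None" if "ob s' i = Some O2" for s' O2
    using that by blast
  have stay: "oneTerm O2 \<and> first_open n O2 = y" if "s \<le> s'" "ob s' i = Some O2" for s' O2
  proof -
    have g: "grows O1 O2" using grows_le[OF that(1) O1(1)] that(2) by auto
    have "z \<in> decided_False n O2" if "z < y" for z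
      using decided_False_grows[OF Correct_live[OF i] O1(1) \<open>ob s' i = Some O2\<close> g y(2)[OF that]] .
    moreover have "y \<notin> decided_False n O2"
      using inact[OF that(2)] by (simp add: decided_False_iff)
    ultimately show ?thesis using g O1(2) by (simp add: first_open_eqI grows_def)
  qed
  obtain s1 O2 where 1: "s \<le> s1" "loop_step i (event_at R s1)" "ob s1 i = Some O2" "pc O2 = Part2"
    using reach_Part2[OF i O1(1)] by blast
  obtain O3 where O3: "ob (Suc s1) i = Some O3"
    "case A of
       Sequential \<Rightarrow> pc O3 = Part1 \<and> (guard2_seq n O2 \<longrightarrow> BC O3 (first_open n O2) \<noteq> None)
     | Concurrent \<Rightarrow> pc O3 = (if guard2_conc n O2 then For 0 else Part1)"
    using step_loop_Part2[OF stepR 1(3,2,4)] by blast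
  show False
  proof (cases A)
    case Sequential
    then show ?thesis
      using O3 inact[OF O3(1)] stay[OF 1(1,3)] inact[OF 1(3)] y(1) by (simp add: guard2_seq_iff)
  next
    case Concurrent
    have "guard2_conc n O2"
      using stay[OF 1(1,3)] inact[OF 1(3)] y(1) by (auto simp: guard2_conc_def)
    then have O3': "pc O3 = For 0" using O3 Concurrent by simp
    \<comment> \<open>The inner loop visits the indices in order, so it reaches \<open>y\<close>,
      where an inactive object is activated.\<close>
    have "\<exists>s' O2. loop_step i (event_at R s') \<and> ob s' i = Some O2 \<and> pc O2 = For k" if "k \<le> y" for k
      using that
    proof (induction k)
      case 0
      then show ?case using next_loop_step[OF i O3(1)] O3' by auto
    next
      case (Suc k)
      then obtain s' O4 where 4: "loop_step i (event_at R s')" "ob s' i = Some O4" "pc O4 = For k"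
        by auto
      then obtain O5 where 5: "ob (Suc s') i = Some O5" "pc O5 = For (Suc k)"
        using step_loop_For[OF stepR 4(2,1,3)] Suc.prems y(1) by (auto simp: next_pos_def)
      then show ?case using next_loop_step[OF i 5(1)] by auto
    qed
    then obtain s' O4 where 4: "loop_step i (event_at R s')" "ob s' i = Some O4" "pc O4 = For y"
      by blast
    then show ?thesis using step_loop_For[OF stepR 4(2,1,3)] inact by auto
  qed
qed

lemma active_decided:
  assumes "i \<in> Correct n R" "ob s i = Some O1" "k < n" "BC O1 k \<noteq> None"
  shows "\<exists>s' O2 b. ob s' i = Some O2 \<and> BC O2 k = Some (Some b)"
proof (cases "BC O1 k = Some None")
  case True
  then obtain s' b where e: "event_at R s' = BinDecide i k b"
    using bc assms unfolding bc_spec_def bc_termination_def by blast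
  show ?thesis using step_decide[OF stepR[of s', unfolded e]] by blast
next
  case False
  then show ?thesis using assms by (metis option.exhaust)
qed

lemma correct_decides:
  assumes i: "i \<in> Correct n R" and act: "ob s i = Some O1"
  shows "\<exists>s v. decides n R i s v"
proof -
  have live: "live i" and "i < n" and nc: "\<And>s. i \<notin> crashed (state_at R s)"
    using i Correct_live by (auto simp: Correct_def)
  \<comment> \<open>This \<open>x\<close> is the index whose proposal is returned; it is below
    \<open>n\<close> by \<open>never_False\<close>.\<close>
  define x where "x = (LEAST x. \<not> dec x False)"
  obtain x0 where x0: "x0 < n" "\<not> dec x0 False"
    using never_False \<open>i < n\<close> by auto
  have "x < n" and x: "\<not> dec x False"
    unfolding x_def using Least_le[of "\<lambda>x. \<not> dec x False", OF x0(2)] x0(1)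
      LeastI[of "\<lambda>x. \<not> dec x False", OF x0(2)] by auto
  have less: "dec y False" if "y < x" for y
    using not_less_Least[OF that[unfolded x_def]] by blast
  \<comment> \<open>Index by index, the objects below \<open>x\<close> become active and decide
    False; the sequential variant activates \<open>BC[y]\<close> only after all smaller ones have
    done so.\<close>
  have "\<exists>s O1. ob s i = Some O1 \<and> oneTerm O1 \<and> (\<forall>z<y. z \<in> decided_False n O1)" if "y \<le> x" for y
    using that
  proof (induction y)
    case 0
    then show ?case using eventually_oneTerm[OF i act] by blast
  next
    case (Suc y)
    then obtain s O1 where 1: "ob s i = Some O1" "oneTerm O1" "\<forall>z<y. z \<in> decided_False n O1"
      by auto
    have "y < n" using Suc.prems \<open>x < n\<close> by simp
    then obtain s1 O2 b where 2: "ob s1 i = Some O2" "BC O2 y = Some (Some b)"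
      using eventually_active[OF i 1(1,2), of y] active_decided[OF i, of _ _ y] 1(3) by metis
    have "b = False"
      using BC_dec[OF live 2] less[of y] Suc.prems dec_unique by auto
    then have y: "y \<in> decided_False n O2" using 2 \<open>y < n\<close> by (simp add: decided_False_iff)
    \<comment> \<open>The earlier decisions and the new one are brought into one common
      state.\<close>
    obtain O3 where 3: "ob (max s s1) i = Some O3" "grows O1 O3"
      using growsE[OF 1(1) max.cobounded1] .
    obtain O3' where "ob (max s s1) i = Some O3'" "grows O2 O3'"
      using growsE[OF 2(1) max.cobounded2] .
    then have "grows O2 O3" using 3 by simp
    have "z \<in> decided_False n O3" if "z < Suc y" for z
      using decided_False_grows[OF live 1(1) 3] decided_False_grows[OF live 2(1) 3(1) \<open>grows O2 O3\<close>]
        1(3) y that by (auto simp: less_Suc_eq)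
    then show ?case using 3 1(2) unfolding grows_def by blast
  qed
  then obtain s1 O1 where 1: "ob s1 i = Some O1" "oneTerm O1" "\<And>z. z < x \<Longrightarrow> z \<in> decided_False n O1"
    by blast
  obtain s2 O2 b where 2: "ob s2 i = Some O2" "BC O2 x = Some (Some b)"
    using eventually_active[OF i 1(1,2) \<open>x < n\<close> 1(3)] active_decided[OF i _ \<open>x < n\<close>] by metis
  have dx: "dec x b" using BC_dec[OF live 2] .
  then have b: "b" using x by (cases b) auto
  \<comment> \<open>A decision True needs a proposal True, whose maker \<open>j\<close> held an
    entry for \<open>x\<close>.\<close>
  then obtain s3 j where e3: "event_at R s3 = BinPropose j x True"
    using dec_proposed[OF dx] by auto
  obtain O3 w where 3: "live j" "ob s3 j = Some O3" "proposals O3 x = Some w"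
    using binProposeD[OF e3] liveI[of j s3] by auto
  then obtain s4 m where 4: "event_at R s4 = UrbDeliver j m" "src m = x"
    using tracedD(4)[OF traced[OF 3(1,2)] 3(3)] by blast
  \<comment> \<open>Although \<open>j\<close> may be faulty, uniform termination brings the message
    that it delivered to \<open>i\<close>.\<close>
  then obtain s5 where s5: "event_at R s5 = UrbDeliver i m"
    using urb i unfolding urb_spec_def urb_termination_def by blast
  \<comment> \<open>The successor of \<open>s5\<close> is taken since the entry is guaranteed only
    after the delivery step.\<close>
  define r where "r = max (max s1 s2) (Suc s5)"
  have r: "s1 \<le> r" "s2 \<le> r" "s5 < r" by (auto simp: r_def)
  obtain O' where O': "ob r i = Some O'" "grows O1 O'" using growsE[OF 1(1) r(1)] .
  have g2: "grows O2 O'" using grows_le[OF r(2) 2(1)] O'(1) by auto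
  obtain b' where b': "BC O' x = Some (Some b')"
    using grows_decided[OF g2 2(2)] by blast
  then have "b'" using dec_unique[OF dx BC_dec[OF live O'(1) b']] b by simp
  have "first_open n O' = x"
    using decided_False_grows[OF live 1(1) O' 1(3)] b' \<open>b'\<close>
    by (intro first_open_eqI) (auto simp: decided_False_iff)
  moreover obtain w' where "proposals O' x = Some w'"
    using delivered_proposal[OF s5 r(3)] O'(1) 4(2) by auto
  moreover have "pval O' \<noteq> None" using tracedD(1)[OF traced[OF live O'(1)]] .
  ultimately have "result n (ob r i) = Val w'"
    using O'(1) b' \<open>b'\<close> \<open>x < n\<close> by (simp add: result_Some Let_def)
  then show ?thesis using \<open>i < n\<close> nc unfolding decides_def by blast
qed

section \<open>Spread of activity from one proposer to all correct processors\<close>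

lemma proposes_active:
  assumes "i \<in> Correct n R" "proposes R i"
  shows "\<exists>s O1. ob s i = Some O1"
proof -
  obtain s where "(\<exists>w. event_at R s = Propose i (Some w)) \<or> activates R i s"
    using assms(2) unfolding proposes_def by blast
  then show ?thesis
  proof (elim disjE exE)
    fix w assume e: "event_at R s = Propose i (Some w)"
    show ?thesis
      using stepR[of s] unfolding e
    proof cases
      case propose
      then have "ob (Suc s) i \<noteq> None"
        by (simp add: set_obj_def after_propose_def)
      then show ?thesis by blast
    qed
  qed (auto simp: activates_def)
qed

text \<open>An active correct processor broadcasts its value, and the delivery activates every
  correct processor that is still inactive.\<close>

lemma all_active:
  assumes "i \<in> Correct n R" "ob s i = Some O1" "j \<in> Correct n R"
  shows "\<exists>s O1. ob s j = Some O1"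
proof -
  obtain s1 O2 d where 1: "ob s1 i = Some O2" "txDes O2 = Some d"
    using eventually_txDes[OF assms(1,2)] by blast
  then obtain s0 m where "event_at R s0 = UrbBroadcast i m"
    using tracedD(3)[OF traced[OF Correct_live[OF assms(1)] 1(1)] 1(2)] by blast
  then obtain s2 where "event_at R s2 = UrbDeliver j m"
    using urb assms(1,3) unfolding urb_spec_def urb_termination_def by blast
  then show ?thesis using delivered_proposal by blast
qed

end

theorem theorem6p6:
  fixes R :: "('v::finite) execution" and A :: variant and n t :: nat
  assumes "2 * t < n"
    and "card ({..<n} - Correct n R) \<le> t"
    and "execution_of A n R"
    and "urb_spec n R"
    and "bc_spec n R"
    and "authentic n R"
  shows "(\<forall>i s v. decides n R i s v \<longrightarrow> (\<exists>j<n. \<exists>s'<s. event_at R s' = Propose j (Some v)))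
       \<and> ((\<exists>i \<in> Correct n R. proposes R i) \<longrightarrow> (\<forall>i \<in> Correct n R. \<exists>s v. decides n R i s v))
       \<and> (\<forall>i j s s' v v'. decides n R i s v \<and> decides n R j s' v' \<longrightarrow> v = v')
       \<and> (\<forall>j s v'. decides n R j s v' \<longrightarrow> \<not> (\<exists>s' v''. v'' \<noteq> v' \<and> decides n R j s' v''))"
proof -
  interpret run R A n
    using assms by unfold_locales (simp_all add: authentic_def)
  have "\<exists>s v. decides n R j s v" if "i \<in> Correct n R" "proposes R i" "j \<in> Correct n R" for i j
    using proposes_active[OF that(1,2)] all_active[OF that(1) _ that(3)] correct_decides[OF that(3)]
    by blast
  \<comment> \<open>Integrity is agreement for one processor in two states.\<close>
  then show ?thesis
    using decides_proposed decides_agree by blast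
qed

end
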